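(* Let $(E,w,d)$ be an ultra triple with $E$ finite, and $r\ge0$ an integer. Let \[ \mathcal{F}_r=\{A\subseteq E:\ \operatorname{per}_r(A)\ge\operatorname{per}_r(B)\text{ for all }B\subseteq E\text{ with }|B|=|A|\}. \] Then $\mathcal{F}_r$ is a strong greedoid on the ground set $E$.
   Context: An ultra triple $(E,w,d)$ consists of a set $E$, an arbitrary function $w:E\to\mathbb{R}$, and a function $d$ defined on pairs of distinct points of $E$ with real values such that $d(a,b)=d(b,a)$ and $d(a,b)\le\max\{d(a,c),d(b,c)\}$ for all pairwise distinct $a,b,c\in E$ (distances may be negative). For a finite set $C\subseteq E$ and $v\in E\setminus C$, $\operatorname{dist}_r(C,v)$ is the maximum over all $S\subseteq C$ with $|S|=|C|-r$ of $\sum_{x\in S}d(v,x)$ if $|C|>r$, and $0$ if $|C|\le r$. For an ordered list $(a_1,\dots,a_k)$ of distinct points, $\operatorname{per}_r((a_1,\dots,a_k))=\sum_{i=1}^k w(a_i)+\sum_{i=1}^k\operatorname{dist}_r(\{a_1,\dots,a_{i-1}\},a_i)$; this does not depend on the ordering, and $\operatorname{per}_r(A)$ denotes the common value for a finite set $A$. A collection $\mathcal{F}\subseteq 2^E$ is a greedoid if (i) $\varnothing\in\mathcal{F}$; (ii) if $A\in\mathcal{F}$ and $|A|>0$, there is $a\in A$ with $A\setminus\{a\}\in\mathcal{F}$; (iii) if $A,B\in\mathcal{F}$ and $|A|=|B|+1$, there is $a\in A\setminus B$ with $B\cup\{a\}\in\mathcal{F}$. It is a strong greedoid if moreover (iv)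 whenever $A,B\in\mathcal{F}$ with $|A|=|B|+1$, there is $a\in A\setminus B$ with both $B\cup\{a\}\in\mathcal{F}$ and $A\setminus\{a\}\in\mathcal{F}$. *)

theory Defs
  imports Complex_Main
begin

text \<open>The weight \<open>w\<close> is unconstrained and the values \<open>d a a\<close> are irrelevant.\<close>

definition ultra_triple :: "'a set \<Rightarrow> ('a \<Rightarrow> real) \<Rightarrow> ('a \<Rightarrow> 'a \<Rightarrow> real) \<Rightarrow> bool" where
  "ultra_triple E w d \<longleftrightarrow>
     (\<forall>a\<in>E. \<forall>b\<in>E. a \<noteq> b \<longrightarrow> d a b = d b a) \<and>
     (\<forall>a\<in>E. \<forall>b\<in>E. \<forall>c\<in>E. a \<noteq> b \<and> a \<noteq> c \<and> b \<noteq> c \<longrightarrow> d a b \<le> max (d a c) (d b c))"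

text \<open>Meant for finite \<open>C\<close> and \<open>v \<notin> C\<close> only.\<close>

definition dist_r :: "('a \<Rightarrow> 'a \<Rightarrow> real) \<Rightarrow> nat \<Rightarrow> 'a set \<Rightarrow> 'a \<Rightarrow> real" where
  "dist_r d r C v =
     (if card C > r then Max {(\<Sum>x\<in>S. d v x) | S. S \<subseteq> C \<and> card S = card C - r} else 0)"

definition per_r_list :: "('a \<Rightarrow> real) \<Rightarrow> ('a \<Rightarrow> 'a \<Rightarrow> real) \<Rightarrow> nat \<Rightarrow> 'a list \<Rightarrow> real" where
  "per_r_list w d r as =
     (\<Sum>i<length as. w (as ! i)) + (\<Sum>i<length as. dist_r d r (set (take i as)) (as ! i))"

text \<open>The common value over all orderings of \<open>A\<close>; it exists for finite subsets of the ground set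
  of an ultra triple by \<open>per_r_eq_list\<close> below.\<close>

definition per_r :: "('a \<Rightarrow> real) \<Rightarrow> ('a \<Rightarrow> 'a \<Rightarrow> real) \<Rightarrow> nat \<Rightarrow> 'a set \<Rightarrow> real" where
  "per_r w d r A = (THE p. \<forall>as. distinct as \<and> set as = A \<longrightarrow> per_r_list w d r as = p)"

definition max_per_family ::
  "'a set \<Rightarrow> ('a \<Rightarrow> real) \<Rightarrow> ('a \<Rightarrow> 'a \<Rightarrow> real) \<Rightarrow> nat \<Rightarrow> 'a set set" where
  "max_per_family E w d r =
     {A. A \<subseteq> E \<and> (\<forall>B. B \<subseteq> E \<and> card B = card A \<longrightarrow> per_r w d r A \<ge> per_r w d r B)}"

definition greedoid :: "'a set \<Rightarrow> 'a set set \<Rightarrow> bool" where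
  "greedoid E F \<longleftrightarrow>
     F \<subseteq> Pow E \<and>
     {} \<in> F \<and>
     (\<forall>A\<in>F. card A > 0 \<longrightarrow> (\<exists>a\<in>A. A - {a} \<in> F)) \<and>
     (\<forall>A\<in>F. \<forall>B\<in>F. card A = card B + 1 \<longrightarrow> (\<exists>a\<in>A - B. B \<union> {a} \<in> F))"

definition strong_greedoid :: "'a set \<Rightarrow> 'a set set \<Rightarrow> bool" where
  "strong_greedoid E F \<longleftrightarrow>
     greedoid E F \<and>
     (\<forall>A\<in>F. \<forall>B\<in>F. card A = card B + 1 \<longrightarrow>
        (\<exists>a\<in>A - B. B \<union> {a} \<in> F \<and> A - {a} \<in> F))"

lemma dist_r_upper:
  assumes "finite C" "S \<subseteq> C" "card S = card C - r" "r \<le> card C"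
  shows "(\<Sum>x\<in>S. d v x) \<le> dist_r d r C v"
proof (cases "card C > r")
  case True
  have "{(\<Sum>x\<in>S. d v x) | S. S \<subseteq> C \<and> card S = card C - r} \<subseteq> (\<lambda>S. \<Sum>x\<in>S. d v x) ` Pow C"
    by auto
  then have "finite {(\<Sum>x\<in>S. d v x) | S. S \<subseteq> C \<and> card S = card C - r}"
    using assms(1) by (meson finite_Pow_iff finite_imageI finite_subset)
  then show ?thesis using True assms unfolding dist_r_def by (auto intro!: Max_ge)
next
  case False
  then have "S = {}" using assms finite_subset by fastforce
  then show ?thesis using False by (simp add: dist_r_def)
qed

lemma dist_r_attained:
  assumes "finite C" "r \<le> card C"
  obtains S where "S \<subseteq> C" "card S = card C - r" "dist_r d r C v = (\<Sum>x\<in>S. d v x)"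
proof (cases "card C > r")
  case True
  let ?M = "{(\<Sum>x\<in>S. d v x) | S. S \<subseteq> C \<and> card S = card C - r}"
  have "?M \<subseteq> (\<lambda>S. \<Sum>x\<in>S. d v x) ` Pow C"
    by auto
  then have fin: "finite ?M"
    using assms(1) by (meson finite_Pow_iff finite_imageI finite_subset)
  obtain S where "S \<subseteq> C" "card S = card C - r"
    using obtain_subset_with_card_n[of "card C - r" C] by auto
  then have "?M \<noteq> {}" by blast
  with fin have "Max ?M \<in> ?M" by (rule Max_in)
  then show ?thesis using True that unfolding dist_r_def by auto
next
  case False
  then show ?thesis using that[of "{}"] assms by (simp add: dist_r_def)
qed

lemma dist_r_swap_le:
  assumes u: "ultra_triple E w d" and C: "finite C" "C \<subseteq> E"
    and ab: "a \<in> E" "b \<in> E" "a \<notin> C" "b \<notin> C" "a \<noteq> b"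
  shows "dist_r d r C a + dist_r d r (insert a C) b \<le> dist_r d r C b + dist_r d r (insert b C) a"
proof (cases "r \<le> card C")
  case False
  then show ?thesis using C ab by (simp add: dist_r_def)
next
  case r: True
  define t where "t = d a b"
  have sym: "d b a = t" using u ab unfolding ultra_triple_def t_def by metis
  have tri1: "d a x \<le> max t (d b x)" and tri2: "d b x \<le> max t (d a x)" if "x \<in> C" for x
  proof -
    have x: "x \<in> E" "x \<noteq> a" "x \<noteq> b" using that C ab by auto
    have "d a x \<le> max (d a b) (d x b)" "d b x \<le> max (d b a) (d x a)" "d x b = d b x" "d x a = d a x"
      using u x ab unfolding ultra_triple_def by metis+
    then show "d a x \<le> max t (d b x)" "d b x \<le> max t (d a x)" using sym t_def by auto
  qed
  have ca: "card (insert a C) = Suc (card C)" and cb: "card (insert b C) = Suc (card C)"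
    using C ab by auto
  obtain S where S: "S \<subseteq> C" "card S = card C - r" "dist_r d r C a = (\<Sum>x\<in>S. d a x)"
    using dist_r_attained[OF C(1) r] by metis
  obtain T where T: "T \<subseteq> insert a C" "card T = Suc (card C) - r"
      "dist_r d r (insert a C) b = (\<Sum>x\<in>T. d b x)"
    using dist_r_attained[of "insert a C" r d b] C r ca by (metis finite_insert le_SucI)
  have finS: "finite S" and finT: "finite T" using S T C finite_subset by (blast, blast)
  have exch: ?thesis
    if T0: "T0 \<subseteq> C" "card T0 = card C - r" "(\<Sum>x\<in>T. d b x) \<le> t + (\<Sum>x\<in>T0. d b x)" for T0
  proof -
    have "(\<Sum>x\<in>T0. d b x) \<le> dist_r d r C b" using dist_r_upper[OF C(1) T0(1,2) r] .
    moreover have "(\<Sum>x\<in>insert b S. d a x) \<le> dist_r d r (insert b C) a"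
      by (rule dist_r_upper) (use C S r ab cb finS in \<open>auto simp: card_insert_if\<close>)
    moreover have "(\<Sum>x\<in>insert b S. d a x) = t + (\<Sum>x\<in>S. d a x)"
      using finS S ab by (subst sum.insert) (auto simp: t_def)
    ultimately show ?thesis using S T T0 by linarith
  qed
  show ?thesis
  proof (cases "\<exists>y\<in>T. d b y \<le> t")
    case True
    then obtain y0 where y0: "y0 \<in> T" "d b y0 \<le> t" by blast
    define y where "y = (if a \<in> T then a else y0)"
    have y: "y \<in> T" "d b y \<le> t" "T - {y} \<subseteq> C" using y0 T(1) sym by (auto simp: y_def)
    have "card (T - {y}) = card C - r" using T y finT r by simp
    moreover have "(\<Sum>x\<in>T. d b x) = d b y + (\<Sum>x\<in>T - {y}. d b x)"
      using sum.remove[OF finT y(1)] .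
    ultimately show ?thesis using exch[of "T - {y}"] y by simp
  next
    case False
    then have big: "d b y > t" if "y \<in> T" for y using that by force
    then have aT: "a \<notin> T" using sym by force
    then have TC: "T \<subseteq> C" using T by auto
    have "(\<Sum>x\<in>T. d b x) \<le> (\<Sum>x\<in>T. d a x)"
    proof (rule sum_mono)
      fix x assume "x \<in> T"
      then show "d b x \<le> d a x" using big[of x] tri2[of x] TC by auto
    qed
    also have "\<dots> \<le> dist_r d r (insert b C) a"
      by (rule dist_r_upper) (use C TC T r cb in auto)
    finally have 1: "dist_r d r (insert a C) b \<le> dist_r d r (insert b C) a" using T by simp
    define G where "G = {x\<in>S. d a x > t}"
    have GS: "G \<subseteq> S" "finite G" using finS by (auto simp: G_def)
    have cSG: "card (S - G) = card S - card G" by (rule card_Diff_subset) (use GS in auto)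
    have "card T - card G \<le> card (T - G)" using GS by (intro diff_card_le_card_Diff) auto
    then have "card (S - G) \<le> card (T - G)" using cSG S T r by linarith
    then obtain U where U: "U \<subseteq> T - G" "card U = card (S - G)" "finite U"
      by (rule obtain_subset_with_card_n)
    have "card (G \<union> U) = card G + card U" by (rule card_Un_disjoint) (use GS U in auto)
    also have "\<dots> = card S" using U cSG card_mono[OF finS GS(1)] by simp
    finally have cGU: "card (G \<union> U) = card S" .
    have "(\<Sum>x\<in>S. d a x) = (\<Sum>x\<in>S - G. d a x) + (\<Sum>x\<in>G. d a x)"
      using sum.subset_diff[OF GS(1) finS] .
    also have "(\<Sum>x\<in>S - G. d a x) \<le> of_nat (card (S - G)) * t"
      by (rule sum_bounded_above) (auto simp: G_def)
    also have "of_nat (card (S - G)) * t \<le> (\<Sum>x\<in>U. d b x)"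
      unfolding U(2)[symmetric] by (rule sum_bounded_below) (use U big in \<open>auto intro: less_imp_le\<close>)
    also have "(\<Sum>x\<in>G. d a x) \<le> (\<Sum>x\<in>G. d b x)"
    proof (rule sum_mono)
      fix x assume "x \<in> G"
      then show "d a x \<le> d b x" using tri1[of x] S(1) by (auto simp: G_def)
    qed
    also have "(\<Sum>x\<in>U. d b x) + (\<Sum>x\<in>G. d b x) = (\<Sum>x\<in>G \<union> U. d b x)"
      using GS U by (subst sum.union_disjoint) auto
    also have "\<dots> \<le> dist_r d r C b"
      by (rule dist_r_upper) (use C cGU S GS U TC r in auto)
    finally have "dist_r d r C a \<le> dist_r d r C b" using S by simp
    with 1 show ?thesis by simp
  qed
qed

lemma per_r_list_snoc:
  "per_r_list w d r (as @ [x]) = per_r_list w d r as + w x + dist_r d r (set as) x"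
proof -
  have "(\<Sum>i<length as. w ((as @ [x]) ! i)) = (\<Sum>i<length as. w (as ! i))"
    by (rule sum.cong) (auto simp: nth_append)
  moreover have "(\<Sum>i<length as. dist_r d r (set (take i (as @ [x]))) ((as @ [x]) ! i)) =
      (\<Sum>i<length as. dist_r d r (set (take i as)) (as ! i))"
    by (rule sum.cong) (auto simp: nth_append)
  ultimately show ?thesis by (simp add: per_r_list_def)
qed

lemma per_r_list_order_independent:
  assumes u: "ultra_triple E w d"
    and "distinct as" "distinct bs" "set as = set bs" "set as \<subseteq> E"
  shows "per_r_list w d r as = per_r_list w d r bs"
  using assms(2-)
proof (induction "length as" arbitrary: as bs rule: less_induct)
  case less
  have len: "length as = length bs" using less.prems by (metis distinct_card)
  show ?case
  proof (cases as rule: rev_cases)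
    case Nil
    then show ?thesis using len by simp
  next
    case (snoc as' x)
    then obtain bs' y where bs: "bs = bs' @ [y]" using len by (cases bs rule: rev_cases) auto
    show ?thesis
    proof (cases "x = y")
      case True
      have s: "set as' = set bs'" using less.prems snoc bs True by auto
      have "per_r_list w d r as' = per_r_list w d r bs'"
        by (rule less.hyps) (use less.prems snoc bs s in auto)
      then show ?thesis using snoc bs True s by (simp add: per_r_list_snoc)
    next
      case False
      obtain zs where zs: "set zs = set as - {x, y}" "distinct zs"
        using finite_distinct_list[of "set as - {x, y}"] by auto
      have s1: "set as' = set (zs @ [y])" using less.prems snoc bs zs False by auto
      have s2: "set bs' = set (zs @ [x])" using less.prems snoc bs zs False by auto
      have xy: "x \<in> E" "y \<in> E" "x \<notin> set zs" "y \<notin> set zs" "set zs \<subseteq> E"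
        using less.prems(3,4) zs(1) unfolding snoc bs by auto
      have "length as' < length as" "length bs' < length as"
        using snoc bs len by simp_all
      moreover have "distinct as'" "distinct bs'"
        using less.prems(1,2) snoc bs by simp_all
      moreover have "distinct (zs @ [y])" "distinct (zs @ [x])"
        using zs(2) xy by simp_all
      moreover have "set as' \<subseteq> E" "set bs' \<subseteq> E"
        unfolding s1 s2 using xy by simp_all
      ultimately have "per_r_list w d r as' = per_r_list w d r (zs @ [y])"
          "per_r_list w d r bs' = per_r_list w d r (zs @ [x])"
        using less.hyps[of as' "zs @ [y]"] less.hyps[of bs' "zs @ [x]"] s1 s2 by blast+
      moreover have "dist_r d r (set zs) x + dist_r d r (insert x (set zs)) y =
          dist_r d r (set zs) y + dist_r d r (insert y (set zs)) x"
        by (rule antisym)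
          (use dist_r_swap_le[OF u finite_set xy(5) xy(1,2,3,4) False]
            dist_r_swap_le[OF u finite_set xy(5) xy(2,1,4,3) False[symmetric]] in blast)+
      ultimately show ?thesis using snoc bs s1 s2 by (simp add: per_r_list_snoc)
    qed
  qed
qed

lemma per_r_eq_list:
  assumes "ultra_triple E w d" "distinct as" "set as \<subseteq> E"
  shows "per_r w d r (set as) = per_r_list w d r as"
  unfolding per_r_def
proof (rule the_equality)
  show "\<forall>bs. distinct bs \<and> set bs = set as \<longrightarrow> per_r_list w d r bs = per_r_list w d r as"
    using per_r_list_order_independent[OF assms(1)] assms by blast
  show "p = per_r_list w d r as"
    if "\<forall>bs. distinct bs \<and> set bs = set as \<longrightarrow> per_r_list w d r bs = p" for p
    using that assms by blast
qed

end

(* Since the weights cancel, everything follows from one exchange inequality: if |A| = |B| + 1, then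
   some a in A - B satisfies dist_r (A - {a}) a <= dist_r B a, so that moving a from A to B does not
   decrease the sum of the two perimeters. The balls of an ultrametric form a tree; descending from
   E to a point, always into a part that contains more points of A than of B, one finds a point a
   such that every ball around a contains more points of A than of B. Hence A - {a} can be matched
   with B so that no distance to a decreases, whatever r is. *)

theory Submission
  imports Defs
begin

text \<open>Induction on the size of \<open>X\<close>: splitting \<open>X\<close> along its largest
  distance leaves a part in which \<open>A\<close> still outnumbers \<open>B\<close>, and the point
  found there also works for \<open>X\<close>. The disjunct \<open>x = a\<close> puts the centre
  into every ball, since \<open>d a a\<close> is arbitrary and \<open>t\<close> ranges over all
  reals, negative ones included.\<close>

lemma exists_point_with_majority_balls:
  fixes d :: "'a \<Rightarrow> 'a \<Rightarrow> real"
  assumes u: "ultra_triple E w d" and "finite X" "X \<subseteq> E" "card (B \<inter> X) < card (A \<inter> X)"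
  shows "\<exists>a\<in>X \<inter> (A - B). \<forall>t. card {x\<in>B \<inter> X. x = a \<or> d a x \<le> t} < card {x\<in>A \<inter> X. x = a \<or> d a x \<le> t}"
  using assms(2-)
proof (induction "card X" arbitrary: X rule: less_induct)
  case less
  have "X \<noteq> {}" using less.prems by auto
  show ?case
  proof (cases "\<exists>x\<in>X. \<exists>y\<in>X. x \<noteq> y")
    case False
    then obtain a where X: "X = {a}" using \<open>X \<noteq> {}\<close> by blast
    then have a: "a \<in> A" "a \<notin> B" using less.prems(3)
      by (cases "a \<in> A"; cases "a \<in> B"; simp)+
    then have *: "{x \<in> B \<inter> X. x = a \<or> d a x \<le> t} = {}"
        "{x \<in> A \<inter> X. x = a \<or> d a x \<le> t} = {a}" for t using X by auto
    show ?thesis by (rule bexI[of _ a]) (unfold *, use a X in auto)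
  next
    case True
    define M where "M = (\<lambda>(x, y). d x y) ` {(x, y)\<in>X \<times> X. x \<noteq> y}"
    define D where "D = Max M"
    have fin: "finite M" unfolding M_def
      by (rule finite_imageI, rule finite_subset[of _ "X \<times> X"]) (use less.prems in auto)
    have "M \<noteq> {}" using True by (auto simp: M_def)
    then have "D \<in> M" using fin by (simp add: D_def)
    then obtain x y where xy: "x \<in> X" "y \<in> X" "x \<noteq> y" "d x y = D" by (auto simp: M_def)
    have le_D: "d p q \<le> D" if "p \<in> X" "q \<in> X" "p \<noteq> q" for p q
      unfolding D_def by (rule Max_ge[OF fin]) (use that in \<open>auto simp: M_def\<close>)
    \<comment> \<open>The open ball of radius \<open>D\<close>, the diameter of \<open>X\<close>,
      around one end of a diametral pair. The other end lies outside, so \<open>Y\<close> and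
      \<open>X - Y\<close> are both proper subsets and the induction hypothesis applies to
      either.\<close>
    define Y where "Y = {z\<in>X. z = x \<or> d x z < D}"
    have Y: "Y \<subseteq> X" "x \<in> Y" "y \<notin> Y" using xy by (auto simp: Y_def)
    have sym: "d p q = d q p" if "p \<in> X" "q \<in> X" for p q
    proof -
      have "\<forall>a\<in>E. \<forall>b\<in>E. a \<noteq> b \<longrightarrow> d a b = d b a"
        using u unfolding ultra_triple_def by (rule conjunct1)
      then show ?thesis using that less.prems(2) by (cases "p = q") auto
    qed
    have ultra: "d p q \<le> max (d p s) (d q s)"
      if "p \<in> X" "q \<in> X" "s \<in> X" "p \<noteq> q" "p \<noteq> s" "q \<noteq> s" for p q s
    proof -
      have "p \<in> E" "q \<in> E" "s \<in> E" using that less.prems(2) by auto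
      moreover have "\<forall>a\<in>E. \<forall>b\<in>E. \<forall>c\<in>E. a \<noteq> b \<and> a \<noteq> c \<and> b \<noteq> c \<longrightarrow> d a b \<le> max (d a c) (d b c)"
        using u unfolding ultra_triple_def by (rule conjunct2)
      ultimately show ?thesis using that(4-) by blast
    qed
    \<comment> \<open>From \<open>d x z < D \<le> d x v\<close> the ultrametric inequality leaves
      only \<open>d v z\<close> to reach \<open>D\<close>. Thus no distance between the two parts is
      below the diameter.\<close>
    have far: "D \<le> d z v" "D \<le> d v z" if zv: "z \<in> Y" "v \<in> X - Y" for z v
    proof -
      have ne: "z \<in> X" "v \<in> X" "x \<noteq> v" "z \<noteq> v" and xv: "D \<le> d x v" using zv Y by (auto simp: Y_def)
      have "D \<le> d z v"
      proof (cases "z = x")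
        case False
        have "d x v \<le> max (d x z) (d v z)"
          by (rule ultra) (use ne False xy(1) in auto)
        moreover have "d x z < D" using zv False by (auto simp: Y_def)
        ultimately show ?thesis using xv sym[OF ne(1,2)] by auto
      qed (use xv in simp)
      then show "D \<le> d z v" "D \<le> d v z" using sym[OF ne(1,2)] by auto
    qed
    have part: ?thesis
      if Z: "Z = Y \<or> Z = X - Y" and more: "card (B \<inter> Z) < card (A \<inter> Z)" for Z
    proof -
      have "Z \<subset> X" using Z Y xy by auto
      then have "card Z < card X" "finite Z" "Z \<subseteq> E"
        using less.prems psubset_card_mono finite_subset by blast+
      from less.hyps[OF this more] obtain a where a: "a \<in> Z" "a \<in> A - B" and
        IH: "\<And>t. card {x\<in>B \<inter> Z. x = a \<or> d a x \<le> t} < card {x\<in>A \<inter> Z. x = a \<or> d a x \<le> t}"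
        by blast
      have aX: "a \<in> X" using a \<open>Z \<subset> X\<close> by auto
      have "card {x\<in>B \<inter> X. x = a \<or> d a x \<le> t} < card {x\<in>A \<inter> X. x = a \<or> d a x \<le> t}" for t
      \<comment> \<open>A ball of radius below \<open>D\<close> around a point of \<open>Z\<close>
        cannot leave \<open>Z\<close>, so the induction hypothesis counts it correctly; a larger
        ball is all of \<open>X\<close>, where \<open>A\<close> has the majority by
        assumption.\<close>
      proof (cases "t < D")
        case True
        have "{x\<in>C \<inter> X. x = a \<or> d a x \<le> t} = {x\<in>C \<inter> Z. x = a \<or> d a x \<le> t}" for C
        proof -
          have "z \<in> Z" if "z \<in> X" "z = a \<or> d a z \<le> t" for z
          proof (rule ccontr)
            assume "z \<notin> Z"
            then have "D \<le> d a z" "z \<noteq> a" using that(1) far[of a z] far[of z a] Z a(1) aX by auto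
            then show False using that(2) True by simp
          qed
          then show ?thesis using \<open>Z \<subset> X\<close> by auto
        qed
        then show ?thesis using IH by simp
      next
        case False
        then have "x = a \<or> d a x \<le> t" if "x \<in> X" for x
          using le_D[OF aX that] by fastforce
        then have "{x\<in>C \<inter> X. x = a \<or> d a x \<le> t} = C \<inter> X" for C by blast
        then show ?thesis using less.prems(3) by simp
      qed
      then show ?thesis using a aX by blast
    qed
    have "card (C \<inter> X) = card (C \<inter> Y) + card (C \<inter> (X - Y))" for C
    proof -
      have "C \<inter> X = C \<inter> Y \<union> C \<inter> (X - Y)" using Y by auto
      moreover have "finite (C \<inter> Y)" "finite (C \<inter> (X - Y))"
        using less.prems(1) Y finite_subset by auto
      moreover have "C \<inter> Y \<inter> (C \<inter> (X - Y)) = {}" by blast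
      ultimately show ?thesis by (metis card_Un_disjoint)
    qed
    \<comment> \<open>The counts add up over the two parts, so \<open>A\<close> cannot lose its
      majority in both.\<close>
    then have "card (B \<inter> Y) < card (A \<inter> Y) \<or> card (B \<inter> (X - Y)) < card (A \<inter> (X - Y))"
      using less.prems(3) by (metis add_le_mono not_less)
    then show ?thesis using part by blast
  qed
qed

text \<open>A greedy matching: pair a maximiser \<open>p\<close> of \<open>g\<close> on
  \<open>P\<close> with a maximiser \<open>q\<close> of \<open>g\<close> on \<open>Q\<close>, then
  recurse on the rest.\<close>

lemma exists_dominating_bij:
  fixes g :: "'a \<Rightarrow> 'b::linorder"
  assumes "finite P" "finite Q" "card P = card Q"
    and "\<And>t. card {x\<in>Q. g x \<le> t} \<le> card {x\<in>P. g x \<le> t}"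
  shows "\<exists>f. bij_betw f P Q \<and> (\<forall>x\<in>P. g x \<le> g (f x))"
  using assms
proof (induction "card P" arbitrary: P Q)
  case 0
  then show ?case by (auto simp: bij_betw_def)
next
  case (Suc n)
  have ne: "P \<noteq> {}" "Q \<noteq> {}" using Suc by auto
  have ex: "\<exists>p\<in>S. \<forall>x\<in>S. g x \<le> g p" if "finite S" "S \<noteq> {}" for S
    using Max_in[of "g ` S"] Max_ge[of "g ` S"] that by fastforce
  obtain p where p: "p \<in> P" "\<And>x. x \<in> P \<Longrightarrow> g x \<le> g p" using ex Suc.prems ne by metis
  obtain q where q: "q \<in> Q" "\<And>x. x \<in> Q \<Longrightarrow> g x \<le> g q" using ex Suc.prems ne by metis
  \<comment> \<open>At the threshold \<open>g q\<close> all of \<open>Q\<close> is counted, hence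
    all of \<open>P\<close> as well.\<close>
  have pq: "g p \<le> g q"
  proof -
    have "{x\<in>Q. g x \<le> g q} = Q" using q by auto
    then have "card P \<le> card {x\<in>P. g x \<le> g q}" using Suc.prems(3) Suc.prems(4)[of "g q"] by simp
    then have "{x\<in>P. g x \<le> g q} = P"
      using Suc.prems(1) card_seteq[of P "{x\<in>P. g x \<le> g q}"] by blast
    then show ?thesis using p by blast
  qed
  have c: "card (P - {p}) = n" "card (Q - {q}) = n" using Suc.hyps(2) Suc.prems p q by simp_all
  \<comment> \<open>The counting hypothesis survives the deletion: from \<open>g p\<close> upwards
    every remaining point of \<open>P\<close> is counted, and below \<open>g p\<close> the point
    \<open>p\<close> was not counted anyway.\<close>
  have "card {x\<in>Q - {q}. g x \<le> t} \<le> card {x\<in>P - {p}. g x \<le> t}" for t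
  proof (cases "g p \<le> t")
    case True
    then have "{x\<in>P - {p}. g x \<le> t} = P - {p}" using p(2) by fastforce
    moreover have "card {x\<in>Q - {q}. g x \<le> t} \<le> card (Q - {q})"
      by (rule card_mono) (use Suc.prems in auto)
    ultimately show ?thesis using c by simp
  next
    case False
    then have "{x\<in>P - {p}. g x \<le> t} = {x\<in>P. g x \<le> t}" by auto
    moreover have "card {x\<in>Q - {q}. g x \<le> t} \<le> card {x\<in>Q. g x \<le> t}"
      by (rule card_mono) (use Suc.prems in auto)
    ultimately show ?thesis using Suc.prems(4)[of t] by simp
  qed
  then obtain f where f: "bij_betw f (P - {p}) (Q - {q})" "\<And>x. x \<in> P - {p} \<Longrightarrow> g x \<le> g (f x)"
    using Suc.hyps(1)[of "P - {p}" "Q - {q}"] c Suc.prems by auto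
  define h where "h = f(p := q)"
  have "bij_betw h (P - {p}) (Q - {q})" using f(1) by (subst bij_betw_cong[of _ _ f]) (auto simp: h_def)
  moreover have "bij_betw h {p} {q}" by (simp add: h_def)
  ultimately have "bij_betw h ((P - {p}) \<union> {p}) ((Q - {q}) \<union> {q})"
    by (rule bij_betw_combine) auto
  moreover have "(P - {p}) \<union> {p} = P" "(Q - {q}) \<union> {q} = Q" using p q by auto
  ultimately have "bij_betw h P Q" by simp
  moreover have "g x \<le> g (h x)" if "x \<in> P" for x using that f(2) pq by (simp add: h_def)
  ultimately show ?case by blast
qed

text \<open>The image under \<open>f\<close> of an optimal subset of \<open>P\<close> has the right
  size to compete in the maximum for \<open>Q\<close>, and its sum is at least as large.\<close>

lemma dist_r_mono_bij:
  assumes "finite P" "finite Q" "bij_betw f P Q" "\<And>x. x \<in> P \<Longrightarrow> d v x \<le> d v (f x)"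
  shows "dist_r d r P v \<le> dist_r d r Q v"
proof (cases "r \<le> card P")
  case False
  then show ?thesis using bij_betw_same_card[OF assms(3)] by (simp add: dist_r_def)
next
  case True
  obtain S where S: "S \<subseteq> P" "card S = card P - r" "dist_r d r P v = (\<Sum>x\<in>S. d v x)"
    using dist_r_attained[OF assms(1) True] by metis
  have inj: "inj_on f S" using assms(3) S(1) by (meson bij_betw_def inj_on_subset)
  have "(\<Sum>x\<in>S. d v x) \<le> (\<Sum>x\<in>S. d v (f x))" using assms(4) S(1) by (intro sum_mono) blast
  also have "\<dots> = (\<Sum>x\<in>f ` S. d v x)" using inj by (simp add: sum.reindex)
  also have "\<dots> \<le> dist_r d r Q v"
    using assms(2,3) S True bij_betw_same_card[OF assms(3)] card_image[OF inj]
    by (intro dist_r_upper) (auto simp: bij_betw_def)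
  finally show ?thesis using S by simp
qed

lemma exists_dist_r_exchange:
  assumes u: "ultra_triple E w d" and fin: "finite E" and sub: "A \<subseteq> E" "B \<subseteq> E"
    and card: "card A = card B + 1"
  shows "\<exists>a\<in>A - B. dist_r d r (A - {a}) a \<le> dist_r d r B a"
proof -
  have finA: "finite A" and finB: "finite B" using sub fin finite_subset by blast+
  have E: "A \<inter> E = A" "B \<inter> E = B" using sub by auto
  obtain a where a: "a \<in> A - B" and
    more: "\<And>t. card {x\<in>B. x = a \<or> d a x \<le> t} < card {x\<in>A. x = a \<or> d a x \<le> t}"
    using exists_point_with_majority_balls[OF u fin order_refl, of B A] card by (auto simp: E)
  \<comment> \<open>Removing \<open>a\<close> from its ball lowers the count for \<open>A\<close> by
    one and leaves that for \<open>B\<close> unchanged; the strict majority pays for this.\<close>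
  have "card {x\<in>B. d a x \<le> t} \<le> card {x\<in>A - {a}. d a x \<le> t}" for t
  proof -
    have "{x\<in>B. x = a \<or> d a x \<le> t} = {x\<in>B. d a x \<le> t}" using a by auto
    moreover have "{x\<in>A. x = a \<or> d a x \<le> t} = insert a {x\<in>A - {a}. d a x \<le> t}" using a by auto
    ultimately show ?thesis using more[of t] finA by simp
  qed
  then obtain f where "bij_betw f (A - {a}) B" "\<forall>x\<in>A - {a}. d a x \<le> d a (f x)"
    using exists_dominating_bij[of "A - {a}" B "d a"] finA finB card a by auto
  then have "dist_r d r (A - {a}) a \<le> dist_r d r B a"
    using dist_r_mono_bij[of "A - {a}" B f d a r] finA finB by blast
  then show ?thesis using a by blast
qed

text \<open>As the order of the points is immaterial, \<open>x\<close> may be listed last.\<close>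

lemma per_r_insert:
  assumes u: "ultra_triple E w d" and "finite C" "insert x C \<subseteq> E" "x \<notin> C"
  shows "per_r w d r (insert x C) = per_r w d r C + w x + dist_r d r C x"
proof -
  obtain as where as: "set as = C" "distinct as" using finite_distinct_list[OF assms(2)] by auto
  have "per_r w d r (set (as @ [x])) = per_r_list w d r (as @ [x])"
    by (rule per_r_eq_list[OF u]) (use as assms in auto)
  moreover have "per_r w d r (set as) = per_r_list w d r as"
    by (rule per_r_eq_list[OF u]) (use as assms in auto)
  ultimately show ?thesis using as by (simp add: per_r_list_snoc)
qed

text \<open>Splitting \<open>a\<close> off from \<open>A\<close> and from \<open>insert a B\<close>
  produces the same term \<open>w a\<close> on both sides, so only the two values of
  \<open>dist_r\<close> have to be compared.\<close>

lemma exists_per_r_exchange: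
  assumes u: "ultra_triple E w d" and fin: "finite E" and sub: "A \<subseteq> E" "B \<subseteq> E"
    and card: "card A = card B + 1"
  shows "\<exists>a\<in>A - B. per_r w d r A + per_r w d r B \<le> per_r w d r (A - {a}) + per_r w d r (insert a B)"
proof -
  obtain a where a: "a \<in> A - B" and le: "dist_r d r (A - {a}) a \<le> dist_r d r B a"
    using exists_dist_r_exchange[OF assms] by blast
  have "finite (A - {a})" "finite B" using sub fin finite_subset by blast+
  then have "per_r w d r (insert a (A - {a})) = per_r w d r (A - {a}) + w a + dist_r d r (A - {a}) a"
    and "per_r w d r (insert a B) = per_r w d r B + w a + dist_r d r B a"
    by (intro per_r_insert[OF u]; use a sub in auto)+
  moreover have "insert a (A - {a}) = A" using a by auto
  ultimately show ?thesis using a le by (intro bexI[of _ a]) simp_all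
qed

lemma max_per_family_exchange:
  assumes u: "ultra_triple E w d" and fin: "finite E"
    and A: "A \<in> max_per_family E w d r" and B: "B \<in> max_per_family E w d r"
    and card: "card A = card B + 1"
  shows "\<exists>a\<in>A - B. B \<union> {a} \<in> max_per_family E w d r \<and> A - {a} \<in> max_per_family E w d r"
proof -
  have sub: "A \<subseteq> E" "B \<subseteq> E" using A B by (auto simp: max_per_family_def)
  obtain a where a: "a \<in> A - B" and
    le: "per_r w d r A + per_r w d r B \<le> per_r w d r (A - {a}) + per_r w d r (insert a B)"
    using exists_per_r_exchange[OF u fin sub card] by blast
  have "finite A" "finite B" using sub fin finite_subset by blast+
  then have c: "card (A - {a}) = card B" "card (insert a B) = card A" using a card by auto
  have s: "A - {a} \<subseteq> E" "insert a B \<subseteq> E" using a sub by auto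
  \<comment> \<open>The exchange swaps the two cardinalities, so optimality of \<open>B\<close>
    bounds the first perimeter and that of \<open>A\<close> the second. With \<open>le\<close>, both
    bounds must be equalities.\<close>
  have "per_r w d r (A - {a}) \<le> per_r w d r B" "per_r w d r (insert a B) \<le> per_r w d r A"
    using A B c s unfolding max_per_family_def by blast+
  with le have "per_r w d r (A - {a}) = per_r w d r B" "per_r w d r (insert a B) = per_r w d r A"
    by simp_all
  then have "A - {a} \<in> max_per_family E w d r" "insert a B \<in> max_per_family E w d r"
    using A B c s unfolding max_per_family_def by simp_all
  then show ?thesis using a by auto
qed

lemma max_per_family_nonempty_level:
  assumes "finite E" "k \<le> card E"
  obtains B where "B \<in> max_per_family E w d r" "card B = k"
proof -
  let ?L = "{B. B \<subseteq> E \<and> card B = k}"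
  have fin: "finite (per_r w d r ` ?L)" using assms(1) by simp
  obtain S where "S \<subseteq> E" "card S = k" using obtain_subset_with_card_n[OF assms(2)] by metis
  then have "per_r w d r ` ?L \<noteq> {}" by blast
  then obtain B where B: "B \<in> ?L" "per_r w d r B = Max (per_r w d r ` ?L)"
    using Max_in[OF fin] by auto
  then have "\<And>C. C \<in> ?L \<Longrightarrow> per_r w d r C \<le> per_r w d r B" using fin by simp
  then show ?thesis using that[of B] B(1) by (simp add: max_per_family_def)
qed

theorem theorem4p2:
  fixes E :: "'a set" and w :: "'a \<Rightarrow> real" and d :: "'a \<Rightarrow> 'a \<Rightarrow> real" and r :: nat
  assumes "ultra_triple E w d" and "finite E"
  shows "strong_greedoid E (max_per_family E w d r)"
proof -
  let ?F = "max_per_family E w d r"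
  have exch: "\<exists>a\<in>A - B. B \<union> {a} \<in> ?F \<and> A - {a} \<in> ?F"
    if "A \<in> ?F" "B \<in> ?F" "card A = card B + 1" for A B
    using max_per_family_exchange[OF assms that] .
  have sub: "?F \<subseteq> Pow E" by (auto simp: max_per_family_def)
  \<comment> \<open>Infinite sets also have \<open>card\<close> 0; finiteness of \<open>E\<close>
    rules them out.\<close>
  have "B = {}" if "B \<subseteq> E" "card B = 0" for B
    using that assms(2) finite_subset by fastforce
  then have empty: "{} \<in> ?F" by (auto simp: max_per_family_def)
  have del: "\<exists>a\<in>A. A - {a} \<in> ?F" if A: "A \<in> ?F" "card A > 0" for A
  proof -
    have "card A \<le> card E" using A sub assms(2) by (intro card_mono) auto
    then have "card A - 1 \<le> card E" by simp
    \<comment> \<open>Deletion is a case of the strong exchange: any optimal set with one point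
      fewer serves as partner for \<open>A\<close>.\<close>
    then obtain B where "B \<in> ?F" "card B = card A - 1"
      using max_per_family_nonempty_level[OF assms(2)] by metis
    then show ?thesis using exch[of A B] A by auto
  qed
  have "greedoid E ?F" unfolding greedoid_def using sub empty del exch by blast
  then show ?thesis unfolding strong_greedoid_def using exch by blast
qed

end
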